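(* Let $f_1,\dots,f_T:\mathbb{R}^D\to\mathbb{R}^D$ be differentiable with Jacobians $A_t=A_t(s_{t-1})=\frac{\partial f_t}{\partial s_{t-1}}(s_{t-1})$. Assume that there are constants $\lambda\in\mathbb{R}$, $a\ge 1$ and $0<b\le 1$ such that for all $t>1$, all $k\ge 0$ (with $t+k-1\le T$) and all $\mathbf{s}=(s_1,\dots,s_T)\in\mathbb{R}^{TD}$, $$b\,e^{\lambda k}\ \le\ \left\|A_{t+k-1}A_{t+k-2}\cdots A_t\right\|_2\ \le\ a\,e^{\lambda k}.$$ Let $\mu:=\inf_{\mathbf{s}\in\mathbb{R}^{TD}}\sigma_{\min}^2(\mathbf{J}(\mathbf{s}))$ be the Polyak–Łojasiewicz (PL) constant of the merit function $\mathcal{L}(\mathbf{s})=\frac12\|\mathbf{r}(\mathbf{s})\|_2^2$. If $\lambda\neq 0$, then $$\frac1a\cdot\frac{e^{\lambda}-1}{e^{\lambda T}-1}\ \le\ \sqrt{\mu}\ \le\ \min\left(\frac1b\cdot\frac{1}{e^{\lambda(T-1)}},\,1\right).$$ If $\lambda=0$, then $$\frac{1}{aT}\ \le\ \sqrt{\mu}\ \le\ \min\left(\frac1b\sqrt{\frac{2D}{T+1}},\,1\right).$$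
   Context: For a fixed initial condition $s_0\in\mathbb{R}^D$, the residual $\mathbf{r}:\mathbb{R}^{TD}\to\mathbb{R}^{TD}$ has blocks $r_t(\mathbf{s})=s_t-f_t(s_{t-1})$, $t=1,\dots,T$. Its Jacobian $\mathbf{J}(\mathbf{s})=\frac{\partial\mathbf{r}}{\partial\mathbf{s}}(\mathbf{s})$ is block lower bidiagonal with $I_D$ on the block diagonal and $-A_t(s_{t-1})$ in block position $(t,t-1)$, $2\le t\le T$. Here $\sigma_{\min}$ is the smallest singular value, $\|\cdot\|_2$ is the spectral norm, and the empty product ($k=0$) is $I_D$. The number $\lambda$ plays the role of the largest Lyapunov exponent $\lim_{T\to\infty}\frac1T\log\|A_T\cdots A_1\|$ of the dynamics. *)

theory Defs
  imports "HOL-Analysis.Analysis"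
begin

text \<open>
  The space of trajectories \<open>(s\<^sub>1, \<dots>, s\<^sub>T)\<close> is \<open>real ^ ('t \<times> 'd)\<close>, where the state space is
  \<open>real ^ 'd\<close> and \<open>'t\<close> is a finite linearly ordered type with \<open>T\<close> elements; the coordinate
  \<open>(i, j)\<close> is the \<open>j\<close>-th component of the block belonging to \<open>i\<close>. The order on \<open>'t\<close>
  identifies its elements with the time steps \<open>1, \<dots>, T\<close>.
\<close>

definition timestep :: "'t::{finite,linorder} \<Rightarrow> nat" where
  "timestep i = card {..i}"

text \<open>
  \<open>state s0 s t\<close> is \<open>s\<^sub>t\<close> for \<open>0 \<le> t \<le> T\<close>, the initial state \<open>s0\<close> being the one at \<open>t = 0\<close>.
  It is meaningless for \<open>t > T\<close>.
\<close>

definition state ::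
  "real ^ 'd \<Rightarrow> real ^ ('t::{finite,linorder} \<times> 'd) \<Rightarrow> nat \<Rightarrow> real ^ 'd" where
  "state s0 s t = (if t = 0 then s0 else (\<chi> j. s $ (inv timestep t, j)))"

definition residual ::
  "(nat \<Rightarrow> real ^ 'd \<Rightarrow> real ^ 'd) \<Rightarrow> real ^ 'd \<Rightarrow>
    real ^ ('t::{finite,linorder} \<times> 'd) \<Rightarrow> real ^ ('t \<times> 'd)" where
  "residual f s0 s =
    (\<chi> p. let t = timestep (fst p)
          in (state s0 s t - f t (state s0 s (t - 1))) $ snd p)"

definition dyn_jacobian ::
  "(nat \<Rightarrow> real ^ 'd \<Rightarrow> real ^ 'd) \<Rightarrow> real ^ 'd \<Rightarrow>
    real ^ ('t::{finite,linorder} \<times> 'd) \<Rightarrow> nat \<Rightarrow> real ^ 'd ^ 'd" where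
  "dyn_jacobian f s0 s t = jacobian (f t) (at (state s0 s (t - 1)))"

text \<open>\<open>A_prod A t k\<close> is \<open>A\<^sub>t\<^sub>+\<^sub>k\<^sub>-\<^sub>1 \<dots> A\<^sub>t\<close>, with later factors on the left.\<close>

primrec A_prod :: "(nat \<Rightarrow> real ^ 'd ^ 'd) \<Rightarrow> nat \<Rightarrow> nat \<Rightarrow> real ^ 'd ^ 'd" where
  "A_prod A t 0 = mat 1"
| "A_prod A t (Suc k) = A (t + k) ** A_prod A t k"

definition spectral_norm :: "real ^ 'n ^ 'm \<Rightarrow> real" where
  "spectral_norm A = onorm ((*v) A)"

text \<open>Singular values of a square matrix: the square roots of the eigenvalues of \<open>A\<^sup>T A\<close>.\<close>

definition singular_values :: "real ^ 'n ^ 'n \<Rightarrow> real set" where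
  "singular_values A =
    {sqrt e | e. \<exists>v. v \<noteq> 0 \<and> (transpose A ** A) *v v = e *\<^sub>R v}"

definition sigma_min :: "real ^ 'n ^ 'n \<Rightarrow> real" where
  "sigma_min A = (LEAST x. x \<in> singular_values A)"

text \<open>
  The Polyak--Lojasiewicz (PL) constant of the merit function \<open>\<lambda>s. (norm (r s))\<^sup>2 / 2\<close>
  is by convention the infimum below, not the optimal constant in the PL inequality.
\<close>

definition PL_constant :: "(real ^ 'n \<Rightarrow> real ^ 'n) \<Rightarrow> real" where
  "PL_constant r = (INF s. (sigma_min (jacobian r (at s)))\<^sup>2)"

end

theory Submission
  imports Defs
begin

text \<open>
  The smallest singular value of a matrix is the least factor by which it stretches a vector; for
  an invertible matrix it is the reciprocal of the spectral norm of the inverse. The Jacobian \<open>J\<close> of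
  the residual is unit block lower bidiagonal, so \<open>J v = y\<close> is a linear recursion in time. Unrolling
  it shows that the block \<open>(t, j)\<close> of the inverse of \<open>J\<close>, for \<open>j \<le> t\<close>, is the product
  \<open>A\<^sub>t \<dots> A\<^sub>j\<^sub>+\<^sub>1\<close>. By hypothesis the spectral norm of this block lies between
  \<open>b * exp (lam * (t - j))\<close> and \<open>a * exp (lam * (t - j))\<close>. The norm of the inverse is then
  estimated in both directions.

  From above: the inverse is the sum of its block subdiagonals, and each of these has the norm of its
  largest block. This leads to the geometric sum of \<open>a * exp (lam * k)\<close> over \<open>k < T\<close>
  (\<open>norm_le_subdiagonal_sum\<close>), uniformly in the trajectory, and hence to the lower bound for the
  infimum over all trajectories.

  From below: a single trajectory suffices to bound the infimum, and \<open>0\<close> is taken. The norm of the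
  inverse dominates that of each block (\<open>sigma_min_block_le\<close>); a diagonal block gives the bound \<open>1\<close>
  and the corner block \<open>(T, 1)\<close> the exponential one. For \<open>lam = 0\<close> no single block need be large, but all
  \<open>T * (T + 1) / 2\<close> of them have norm at least \<open>b\<close>, and the Frobenius norm sees them together
  (\<open>sigma_min_Frobenius\<close>); passing back to the spectral norm costs the factor \<open>T * CARD('d)\<close> in
  the squares.

  The inverse matrix itself is never formed: all statements are about \<open>norm v\<close> and \<open>norm (J *v v)\<close>.
\<close>

section \<open>The smallest singular value as a minimal stretching factor\<close>

lemma inner_transpose_mult_self:
  fixes A :: "real ^ 'n ^ 'n"
  shows "((transpose A ** A) *v u) \<bullet> w = (A *v u) \<bullet> (A *v w)"
  by (metis dot_lmul_matrix matrix_vector_mul_assoc transpose_matrix_vector)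

text \<open>
  The quadratic form \<open>(norm (A *v u))\<^sup>2 - m\<^sup>2 * (norm u)\<^sup>2\<close> is nonnegative and vanishes at \<open>v\<close>, so
  its gradient there, which is twice the vector \<open>z\<close> below, is \<open>0\<close>.
\<close>

lemma minimal_stretching_is_eigenvector:
  fixes A :: "real ^ 'n ^ 'n"
  assumes min: "\<And>u. m * norm u \<le> norm (A *v u)" and m: "0 \<le> m"
    and attained: "norm (A *v v) = m * norm v"
  shows "(transpose A ** A) *v v = m\<^sup>2 *\<^sub>R v"
proof -
  have pos: "0 \<le> (A *v u) \<bullet> (A *v u) - m\<^sup>2 * (u \<bullet> u)" for u
    using power_mono[OF min[of u], of 2] m
    by (simp add: power_mult_distrib power2_norm_eq_inner)
  have zero: "(A *v v) \<bullet> (A *v v) = m\<^sup>2 * (v \<bullet> v)"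
    using attained by (metis power_mult_distrib power2_norm_eq_inner)
  define z where "z = (transpose A ** A) *v v - m\<^sup>2 *\<^sub>R v"
  define c where "c = (A *v z) \<bullet> (A *v z) - m\<^sup>2 * (z \<bullet> z)"
  have c: "0 \<le> c"
    unfolding c_def by (rule pos)
  have gradient: "(A *v v) \<bullet> (A *v z) = z \<bullet> z + m\<^sup>2 * (v \<bullet> z)"
    by (subst (2) z_def) (simp add: inner_diff_left inner_transpose_mult_self)
  have quad: "0 \<le> 2 * x * (z \<bullet> z) + x\<^sup>2 * c" for x
  proof -
    have "(A *v (v + x *\<^sub>R z)) \<bullet> (A *v (v + x *\<^sub>R z)) - m\<^sup>2 * ((v + x *\<^sub>R z) \<bullet> (v + x *\<^sub>R z))
        = ((A *v v) \<bullet> (A *v v) - m\<^sup>2 * (v \<bullet> v)) + 2 * x * (z \<bullet> z) + x\<^sup>2 * c"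
      unfolding c_def
      by (simp add: inner_commute[of "A *v z" "A *v v"] inner_commute[of z v] gradient
          power2_eq_square algebra_simps)
    then show ?thesis
      using pos[of "v + x *\<^sub>R z"] zero by simp
  qed
  \<comment> \<open>A step of this size against the gradient \<open>z\<close> makes the linear term win, the \<open>+ 1\<close>
      keeping the denominator positive.\<close>
  have step: "2 * (- (z \<bullet> z) / (c + 1)) * (z \<bullet> z) + (- (z \<bullet> z) / (c + 1))\<^sup>2 * c
      = - ((z \<bullet> z)\<^sup>2 * (c + 2)) / (c + 1)\<^sup>2"
    using c by (simp add: power2_eq_square divide_simps) algebra
  have "z = 0"
    using quad[of "- (z \<bullet> z) / (c + 1)"] c unfolding step
    by (auto simp: divide_le_0_iff mult_le_0_iff)
  then show ?thesis
    by (simp add: z_def)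
qed

text \<open>
  The minimum of \<open>norm (A *v v)\<close> over the compact unit sphere exists; it is the smallest
  singular value because its minimizer is an eigenvector and no eigenvector does better.
\<close>

lemma sigma_min_least_stretching:
  fixes A :: "real ^ 'n ^ 'n"
  shows sigma_min_le: "sigma_min A * norm v \<le> norm (A *v v)"
    and sigma_min_attained: "\<exists>v. v \<noteq> 0 \<and> norm (A *v v) = sigma_min A * norm v"
proof -
  have "continuous_on (sphere 0 1) (\<lambda>v. norm (A *v v))"
    by (intro continuous_on_norm linear_continuous_on matrix_vector_mul_bounded_linear)
  moreover have "sphere (0 :: real ^ 'n) 1 \<noteq> {}"
    by (metis dist_0_norm norm_axis_1 mem_sphere empty_iff)
  ultimately obtain v where v: "norm v = 1"
    and least: "\<And>u. norm u = 1 \<Longrightarrow> norm (A *v v) \<le> norm (A *v u)"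
    using continuous_attains_inf[of "sphere 0 1" "\<lambda>v. norm (A *v v)"] by auto
  define m where "m = norm (A *v v)"
  have m: "0 \<le> m"
    by (simp add: m_def)
  have stretch: "m * norm u \<le> norm (A *v u)" for u
  proof (cases "u = 0")
    case False
    then have "m \<le> norm (A *v (inverse (norm u) *\<^sub>R u))"
      unfolding m_def by (intro least) simp
    also have "\<dots> = norm (A *v u) / norm u"
      by (simp add: matrix_vector_mult_scaleR divide_inverse mult.commute)
    finally show ?thesis
      using False by (simp add: pos_le_divide_eq)
  qed simp
  have "(transpose A ** A) *v v = m\<^sup>2 *\<^sub>R v"
    by (rule minimal_stretching_is_eigenvector[OF stretch m]) (simp add: m_def v)
  then have "m \<in> singular_values A"
    unfolding singular_values_def using v m
    by (auto intro!: exI[of _ "m\<^sup>2"] exI[of _ v])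
  moreover have "m \<le> x" if x_sing: "x \<in> singular_values A" for x
  proof -
    obtain e u where x: "x = sqrt e" and u: "u \<noteq> 0" and e: "(transpose A ** A) *v u = e *\<^sub>R u"
      using x_sing unfolding singular_values_def by blast
    have "m\<^sup>2 * (u \<bullet> u) \<le> (A *v u) \<bullet> (A *v u)"
      using power_mono[OF stretch[of u], of 2] m
      by (simp add: power_mult_distrib power2_norm_eq_inner)
    also have "\<dots> = e * (u \<bullet> u)"
      using inner_transpose_mult_self[of A u u] e by simp
    finally have "m\<^sup>2 \<le> e"
      using u by simp
    then show "m \<le> x"
      using real_le_rsqrt x by blast
  qed
  ultimately have eq: "sigma_min A = m"
    unfolding sigma_min_def by (rule Least_equality)
  show "sigma_min A * norm v \<le> norm (A *v v)" for v
    using stretch eq by simp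
  show "\<exists>v. v \<noteq> 0 \<and> norm (A *v v) = sigma_min A * norm v"
    using v eq by (intro exI[of _ v]) (auto simp: m_def)
qed

lemma sigma_min_nonneg: "0 \<le> sigma_min A"
proof -
  obtain v where "v \<noteq> 0" "norm (A *v v) = sigma_min A * norm v"
    using sigma_min_attained by blast
  then have "0 \<le> sigma_min A * norm v"
    by (metis norm_ge_zero)
  with \<open>v \<noteq> 0\<close> show ?thesis
    by (simp add: zero_le_mult_iff)
qed

lemma sigma_min_ge:
  assumes "\<And>v. c * norm v \<le> norm (A *v v)"
  shows "c \<le> sigma_min A"
proof -
  obtain v where "v \<noteq> 0" "norm (A *v v) = sigma_min A * norm v"
    using sigma_min_attained by blast
  with assms[of v] show ?thesis
    by simp
qed

lemma spectral_norm_bound: "norm (A *v x) \<le> spectral_norm A * norm x"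
  unfolding spectral_norm_def by (rule onorm[OF matrix_vector_mul_bounded_linear])

lemma spectral_norm_nonneg: "0 \<le> spectral_norm A"
  unfolding spectral_norm_def by (rule onorm_pos_le[OF matrix_vector_mul_bounded_linear])

lemma spectral_norm_le_Frobenius:
  fixes A :: "real ^ 'n ^ 'm"
  shows "(spectral_norm A)\<^sup>2 \<le> (\<Sum>i\<in>UNIV. (norm (A *v axis i 1))\<^sup>2)"
proof -
  let ?F = "L2_set (\<lambda>i. norm (A *v axis i 1)) UNIV"
  have "norm (A *v x) \<le> ?F * norm x" for x
  proof -
    have "norm (A *v x) = norm (\<Sum>i\<in>UNIV. x $ i *\<^sub>R (A *v axis i 1))"
      by (simp add: matrix_mult_sum[of A x] matrix_vector_mult_basis scalar_mult_eq_scaleR)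
    also have "\<dots> \<le> (\<Sum>i\<in>UNIV. \<bar>norm (A *v axis i 1)\<bar> * \<bar>x $ i\<bar>)"
      by (rule order_trans[OF norm_sum]) (simp add: mult.commute)
    also have "\<dots> \<le> ?F * L2_set (\<lambda>i. x $ i) UNIV"
      by (rule L2_set_mult_ineq)
    finally show ?thesis
      by (simp add: norm_vec_def L2_set_def)
  qed
  then have "spectral_norm A \<le> ?F"
    unfolding spectral_norm_def by (rule onorm_bound[OF L2_set_nonneg])
  then have "(spectral_norm A)\<^sup>2 \<le> ?F\<^sup>2"
    by (rule power_mono[OF _ spectral_norm_nonneg])
  then show ?thesis
    by (simp add: L2_set_def sum_nonneg)
qed

section \<open>Trajectories as sequences of blocks\<close>

text \<open>
  With initial state \<open>0\<close>, \<open>state\<close> is linear in the trajectory. Its value \<open>0\<close> at time \<open>0\<close> lets the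
  first block row of a bidiagonal matrix obey the same formula as the others.
\<close>

abbreviation block :: "real ^ ('t::{finite,linorder} \<times> 'd::finite) \<Rightarrow> nat \<Rightarrow> real ^ 'd" where
  "block \<equiv> state 0"

lemma bij_betw_timestep:
  "bij_betw (timestep :: 't::{finite,linorder} \<Rightarrow> nat) UNIV {1..CARD('t)}"
proof -
  have "strict_mono (timestep :: 't \<Rightarrow> nat)"
    unfolding strict_mono_def timestep_def by (auto intro!: psubset_card_mono)
  then have inj: "inj (timestep :: 't \<Rightarrow> nat)"
    by (rule strict_mono_imp_inj_on)
  have "card {..i} \<le> CARD('t)" for i :: 't
    by (rule card_mono) auto
  then have "range (timestep :: 't \<Rightarrow> nat) \<subseteq> {1..CARD('t)}"
    by (auto simp: timestep_def Suc_le_eq card_gt_0_iff)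
  then have "range (timestep :: 't \<Rightarrow> nat) = {1..CARD('t)}"
    by (intro card_subset_eq) (auto simp: card_image[OF inj])
  with inj show ?thesis
    by (simp add: bij_betw_def)
qed

lemma timestep_bounds:
  "1 \<le> timestep i" "timestep (i :: 't::{finite,linorder}) \<le> CARD('t)"
  using bij_betw_apply[OF bij_betw_timestep, of i] by auto

lemma block_0 [simp]: "block v 0 = 0"
  by (simp add: state_def)

lemma state_timestep [simp]: "state s0 v (timestep i) $ j = v $ (i, j)"
proof -
  have "inv timestep (timestep i) = i"
    by (rule inv_f_f[OF bij_betw_imp_inj_on[OF bij_betw_timestep]])
  then show ?thesis
    using timestep_bounds(1)[of i] by (simp add: state_def)
qed

lemma linear_block: "linear (\<lambda>v. block v t)"
  by (rule linearI) (auto simp: state_def vec_eq_iff)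

lemma state_has_derivative:
  fixes s :: "real ^ ('t::{finite,linorder} \<times> 'd::finite)"
  shows "((\<lambda>s. state s0 s t) has_derivative (\<lambda>v. block v t)) (at s)"
proof -
  have "((\<lambda>s. state s0 (0 :: real ^ ('t \<times> 'd)) t + block s t)
      has_derivative (\<lambda>v. 0 + block v t)) (at s)"
    by (intro has_derivative_add has_derivative_const bounded_linear_imp_has_derivative)
      (simp add: linear_conv_bounded_linear[symmetric] linear_block)
  moreover have "(\<lambda>s :: real ^ ('t \<times> 'd). state s0 s t)
      = (\<lambda>s. state s0 (0 :: real ^ ('t \<times> 'd)) t + block s t)"
    by (auto simp: state_def vec_eq_iff)
  ultimately show ?thesis
    by (simp only: add_0)
qed

lemma obtain_trajectory:
  assumes "x 0 = 0"
  obtains v :: "real ^ ('t::{finite,linorder} \<times> 'd::finite)"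
  where "\<And>t. t \<le> CARD('t) \<Longrightarrow> block v t = x t"
proof
  let ?v = "(\<chi> p. x (timestep (fst p)) $ snd p) :: real ^ ('t \<times> 'd)"
  fix t assume t: "t \<le> CARD('t)"
  show "block ?v t = x t"
  proof (cases "t = 0")
    case False
    then have "t \<in> timestep ` (UNIV :: 't set)"
      using t bij_betw_timestep[where 't='t] by (simp add: bij_betw_def)
    then obtain i :: 't where "t = timestep i"
      by blast
    then show ?thesis
      by (simp add: vec_eq_iff)
  qed (simp add: assms)
qed

lemma norm_eq_L2_set_blocks:
  fixes v :: "real ^ ('t::{finite,linorder} \<times> 'd::finite)"
  shows "norm v = L2_set (\<lambda>t. norm (block v t)) {1..CARD('t)}"
proof -
  have "(\<Sum>p\<in>UNIV. (v $ p)\<^sup>2) = (\<Sum>i\<in>UNIV. \<Sum>j\<in>UNIV. (v $ (i, j))\<^sup>2)"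
    by (simp add: sum.cartesian_product)
  also have "\<dots> = (\<Sum>i\<in>(UNIV :: 't set). (norm (block v (timestep i)))\<^sup>2)"
    by (simp add: norm_vec_def L2_set_def sum_nonneg)
  also have "\<dots> = (\<Sum>t\<in>{1..CARD('t)}. (norm (block v t))\<^sup>2)"
    by (rule sum.reindex_bij_betw[OF bij_betw_timestep])
  finally show ?thesis
    by (simp add: norm_vec_def L2_set_def)
qed

lemma norm_eq_L2_set_blocks_sq:
  fixes v :: "real ^ ('t::{finite,linorder} \<times> 'd::finite)"
  shows "(norm v)\<^sup>2 = (\<Sum>t\<in>{1..CARD('t)}. (norm (block v t))\<^sup>2)"
  by (simp add: norm_eq_L2_set_blocks L2_set_def sum_nonneg)

lemma L2_set_sum_le: "L2_set (\<lambda>t. \<Sum>k\<in>K. g k t) A \<le> (\<Sum>k\<in>K. L2_set (g k) A)"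
proof (induction K rule: infinite_finite_induct)
  case (insert k K)
  then show ?case
    using L2_set_triangle_ineq[of "g k" "\<lambda>t. \<Sum>k\<in>K. g k t" A] by simp
qed (simp_all add: L2_set_def)

text \<open>
  Truncated subtraction sends the first \<open>k\<close> indices to \<open>0\<close>, where \<open>y\<close> vanishes.
\<close>

lemma L2_set_shift_le:
  fixes y :: "nat \<Rightarrow> real"
  assumes "y 0 = 0"
  shows "L2_set (\<lambda>t. y (t - k)) {1..n} \<le> L2_set y {1..n}"
proof -
  have "(\<Sum>t\<in>{1..n}. (y (t - k))\<^sup>2) = (\<Sum>t\<in>{k+1..n}. (y (t - k))\<^sup>2)"
    by (rule sum.mono_neutral_right) (auto simp: assms)
  also have "\<dots> = (\<Sum>t\<in>{1..n-k}. (y t)\<^sup>2)"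
    by (rule sum.reindex_bij_witness[of _ "\<lambda>t. t + k" "\<lambda>t. t - k"]) auto
  also have "\<dots> \<le> (\<Sum>t\<in>{1..n}. (y t)\<^sup>2)"
    by (rule sum_mono2) auto
  finally show ?thesis
    by (simp add: L2_set_def)
qed

section \<open>Block bidiagonal matrices\<close>

locale block_bidiagonal =
  fixes A :: "nat \<Rightarrow> real ^ 'd::finite ^ 'd"
    and J :: "real ^ ('t::{finite,linorder} \<times> 'd::finite) ^ ('t \<times> 'd)"
  assumes block_mult:
    "\<And>v t. 1 \<le> t \<Longrightarrow> t \<le> CARD('t) \<Longrightarrow> block (J *v v) t = block v t - A t *v block v (t - 1)"
begin

text \<open>
  Unrolling the recursion \<open>block v t = block (J *v v) t + A t *v block v (t - 1)\<close>. The terms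
  with a given \<open>k\<close> form the \<open>k\<close>-th block subdiagonal of the inverse of \<open>J\<close>.
\<close>

lemma block_solution:
  assumes "t \<le> CARD('t)"
  shows "block v t = (\<Sum>k<t. A_prod A (t - k + 1) k *v block (J *v v) (t - k))"
  using assms
proof (induction t)
  case (Suc t)
  have "block v (Suc t) = block (J *v v) (Suc t) + A (Suc t) *v block v t"
    using block_mult[of "Suc t" v] Suc.prems by simp
  also have "A (Suc t) *v block v t
      = (\<Sum>k<t. A (Suc t) *v (A_prod A (t - k + 1) k *v block (J *v v) (t - k)))"
    using Suc by (simp add: linear_sum[OF matrix_vector_mul_linear] del: A_prod.simps)
  also have "\<dots> = (\<Sum>k<t. A_prod A (Suc t - Suc k + 1) (Suc k) *v block (J *v v) (Suc t - Suc k))"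
    by (rule sum.cong) (simp_all add: matrix_vector_mul_assoc)
  finally show ?case
    by (subst sum.lessThan_Suc_shift) (simp del: A_prod.simps(2))
qed simp

text \<open>
  A block subdiagonal acts blockwise after a shift, so its norm is the largest norm of its blocks;
  the norm of the inverse of \<open>J\<close> is at most the sum over all subdiagonals.
\<close>

lemma norm_le_subdiagonal_sum:
  assumes le: "\<And>t k. 1 < t \<Longrightarrow> t + k - 1 \<le> CARD('t) \<Longrightarrow> spectral_norm (A_prod A t k) \<le> c k"
    and c: "\<And>k. 0 \<le> c k"
  shows "norm v \<le> (\<Sum>k<CARD('t). c k) * norm (J *v v)"
proof -
  let ?T = "CARD('t)"
  let ?y = "\<lambda>t. norm (block (J *v v) t)"
  have "norm (block v t) \<le> (\<Sum>k<?T. c k * ?y (t - k))" if t: "t \<in> {1..?T}" for t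
  proof -
    have "norm (block v t) \<le> (\<Sum>k<t. norm (A_prod A (t - k + 1) k *v block (J *v v) (t - k)))"
      using t by (subst block_solution) (auto intro: norm_sum)
    also have "\<dots> \<le> (\<Sum>k<t. c k * ?y (t - k))"
    proof (rule sum_mono)
      fix k assume "k \<in> {..<t}"
      then have "spectral_norm (A_prod A (t - k + 1) k) \<le> c k"
        using t by (intro le) auto
      then show "norm (A_prod A (t - k + 1) k *v block (J *v v) (t - k)) \<le> c k * ?y (t - k)"
        by (intro order_trans[OF spectral_norm_bound] mult_right_mono) auto
    qed
    also have "\<dots> \<le> (\<Sum>k<?T. c k * ?y (t - k))"
      using t c by (intro sum_mono2) auto
    finally show ?thesis .
  qed
  then have "norm v \<le> L2_set (\<lambda>t. \<Sum>k<?T. c k * ?y (t - k)) {1..?T}"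
    unfolding norm_eq_L2_set_blocks[of v] by (intro L2_set_mono) auto
  also have "\<dots> \<le> (\<Sum>k<?T. c k * L2_set (\<lambda>t. ?y (t - k)) {1..?T})"
    using L2_set_sum_le[of "\<lambda>k t. c k * ?y (t - k)" "{..<?T}" "{1..?T}"]
    by (simp add: L2_set_right_distrib[OF c])
  also have "\<dots> \<le> (\<Sum>k<?T. c k * norm (J *v v))"
    unfolding norm_eq_L2_set_blocks[of "J *v v"]
    by (intro sum_mono mult_left_mono c L2_set_shift_le) simp
  finally show ?thesis
    by (simp add: sum_distrib_right)
qed

text \<open>
  The \<open>j\<close>-th block column of the inverse of \<open>J\<close>, applied to \<open>w\<close>, is the trajectory started at
  time \<open>j\<close> in \<open>w\<close>.
\<close>

lemma sigma_min_column:
  assumes j: "1 \<le> j" "j \<le> CARD('t)"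
  shows "(sigma_min J)\<^sup>2 * (\<Sum>t=j..CARD('t). (norm (A_prod A (j + 1) (t - j) *v w))\<^sup>2) \<le> (norm w)\<^sup>2"
proof -
  let ?T = "CARD('t)"
  define x where "x t = (if t < j then 0 else A_prod A (j + 1) (t - j) *v w)" for t
  obtain v :: "real ^ ('t \<times> 'd)" where v: "\<And>t. t \<le> ?T \<Longrightarrow> block v t = x t"
    using obtain_trajectory[of x, where 't='t] j by (auto simp: x_def)
  have Jv: "block (J *v v) t = (if t = j then w else 0)" if t: "t \<in> {1..?T}" for t
  proof -
    have "block (J *v v) t = x t - A t *v x (t - 1)"
      using t v[of t] v[of "t - 1"] by (auto simp: block_mult)
    also have "\<dots> = (if t = j then w else 0)"
    proof (cases "t > j")
      case True
      then obtain n where "t = Suc (j + n)"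
        using less_imp_Suc_add by blast
      then show ?thesis
        by (simp add: x_def matrix_vector_mul_assoc)
    next
      case False
      then show ?thesis
        using t by (auto simp: x_def)
    qed
    finally show ?thesis .
  qed
  have "(norm (J *v v))\<^sup>2 = (\<Sum>t\<in>{1..?T}. if t = j then (norm w)\<^sup>2 else 0)"
    unfolding norm_eq_L2_set_blocks_sq by (rule sum.cong) (auto simp: Jv)
  then have "(norm (J *v v))\<^sup>2 = (norm w)\<^sup>2"
    using j by simp
  moreover have "(norm v)\<^sup>2 = (\<Sum>t=j..?T. (norm (A_prod A (j + 1) (t - j) *v w))\<^sup>2)"
  proof -
    have "(norm v)\<^sup>2 = (\<Sum>t\<in>{1..?T}. (norm (x t))\<^sup>2)"
      unfolding norm_eq_L2_set_blocks_sq by (rule sum.cong) (auto simp: v)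
    also have "\<dots> = (\<Sum>t=j..?T. (norm (x t))\<^sup>2)"
      by (rule sum.mono_neutral_right) (use j in \<open>auto simp: x_def\<close>)
    also have "\<dots> = (\<Sum>t=j..?T. (norm (A_prod A (j + 1) (t - j) *v w))\<^sup>2)"
      by (rule sum.cong) (auto simp: x_def)
    finally show ?thesis .
  qed
  moreover have "(sigma_min J * norm v)\<^sup>2 \<le> (norm (J *v v))\<^sup>2"
    by (intro power_mono sigma_min_le mult_nonneg_nonneg sigma_min_nonneg norm_ge_zero)
  ultimately show ?thesis
    by (simp add: power_mult_distrib)
qed

text \<open>No block of the inverse of \<open>J\<close> has a larger norm than the inverse itself.\<close>

lemma sigma_min_block_le:
  assumes "1 \<le> j" "j \<le> t" "t \<le> CARD('t)"
  shows "sigma_min J * spectral_norm (A_prod A (j + 1) (t - j)) \<le> 1"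
proof (cases "sigma_min J = 0")
  case False
  then have pos: "0 < sigma_min J"
    using sigma_min_nonneg[of J] by linarith
  let ?M = "A_prod A (j + 1) (t - j)"
  have "norm (?M *v w) \<le> 1 / sigma_min J * norm w" for w
  proof -
    have "(sigma_min J * norm (?M *v w))\<^sup>2
        \<le> (sigma_min J)\<^sup>2 * (\<Sum>t=j..CARD('t). (norm (A_prod A (j + 1) (t - j) *v w))\<^sup>2)"
      unfolding power_mult_distrib using assms
      by (intro mult_left_mono member_le_sum[of t _ "\<lambda>t. (norm (A_prod A (j + 1) (t - j) *v w))\<^sup>2"])
        auto
    also have "\<dots> \<le> (norm w)\<^sup>2"
      using assms by (intro sigma_min_column) auto
    finally have "sigma_min J * norm (?M *v w) \<le> norm w"
      by (rule power2_le_imp_le) simp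
    then show ?thesis
      using pos by (simp add: field_simps)
  qed
  then have "spectral_norm ?M \<le> 1 / sigma_min J"
    unfolding spectral_norm_def using pos by (intro onorm_bound) auto
  then show ?thesis
    using pos by (simp add: field_simps)
qed simp

text \<open>
  The squared Frobenius norm of the inverse of \<open>J\<close>, a square matrix with \<open>CARD('t) * CARD('d)\<close>
  columns, is at most that number times the square of its spectral norm; it is also the sum of the
  squared Frobenius norms of the blocks.
\<close>

lemma sigma_min_Frobenius:
  "(sigma_min J)\<^sup>2 * (\<Sum>j=1..CARD('t). \<Sum>t=j..CARD('t). (spectral_norm (A_prod A (j + 1) (t - j)))\<^sup>2)
    \<le> real CARD('t) * real CARD('d)"
proof -
  let ?T = "CARD('t)"
  have "(sigma_min J)\<^sup>2 * (\<Sum>t=j..?T. (spectral_norm (A_prod A (j + 1) (t - j)))\<^sup>2) \<le> real CARD('d)"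
    if j: "j \<in> {1..?T}" for j
  proof -
    have "(\<Sum>t=j..?T. (spectral_norm (A_prod A (j + 1) (t - j)))\<^sup>2)
        \<le> (\<Sum>t=j..?T. \<Sum>i\<in>UNIV. (norm (A_prod A (j + 1) (t - j) *v axis i 1))\<^sup>2)"
      by (intro sum_mono spectral_norm_le_Frobenius)
    also have "\<dots> = (\<Sum>i\<in>UNIV. \<Sum>t=j..?T. (norm (A_prod A (j + 1) (t - j) *v axis i 1))\<^sup>2)"
      by (rule sum.swap)
    finally have "(sigma_min J)\<^sup>2 * (\<Sum>t=j..?T. (spectral_norm (A_prod A (j + 1) (t - j)))\<^sup>2)
        \<le> (\<Sum>i\<in>UNIV. (sigma_min J)\<^sup>2
            * (\<Sum>t=j..?T. (norm (A_prod A (j + 1) (t - j) *v axis i 1))\<^sup>2))"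
      unfolding sum_distrib_left[symmetric] by (rule mult_left_mono) simp
    also have "\<dots> \<le> (\<Sum>i\<in>(UNIV :: 'd set). (norm (axis i 1 :: real ^ 'd))\<^sup>2)"
      using j by (intro sum_mono sigma_min_column) auto
    finally show ?thesis
      by simp
  qed
  then have "(\<Sum>j=1..?T. (sigma_min J)\<^sup>2 * (\<Sum>t=j..?T. (spectral_norm (A_prod A (j + 1) (t - j)))\<^sup>2))
      \<le> (\<Sum>j=1..?T. real CARD('d))"
    by (rule sum_mono)
  then show ?thesis
    by (simp add: sum_distrib_left[symmetric])
qed

end

section \<open>The Jacobian of the residual and the PL constant\<close>

text \<open>
  The initial state does not vary with the trajectory; in the first block row this is expressed by
  \<open>block v 0 = 0\<close>, which removes the Jacobian of \<open>f 1\<close>.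
\<close>

lemma residual_block_bidiagonal:
  fixes s :: "real ^ ('t::{finite,linorder} \<times> 'd::finite)"
  assumes diff: "\<And>t x. 1 \<le> t \<Longrightarrow> t \<le> CARD('t) \<Longrightarrow> f t differentiable (at x)"
  shows "block_bidiagonal (dyn_jacobian f s0 s) (jacobian (residual f s0) (at s))"
proof
  fix v :: "real ^ ('t \<times> 'd)" and t
  assume t: "1 \<le> t" "t \<le> CARD('t)"
  let ?A = "dyn_jacobian f s0 s"
  let ?R = "\<lambda>v :: real ^ ('t \<times> 'd). \<chi> p.
    (block v (timestep (fst p)) - ?A (timestep (fst p)) *v block v (timestep (fst p) - 1)) $ snd p"
  have step: "((\<lambda>s. state s0 s n - f n (state s0 s (n - 1))) has_derivative
      (\<lambda>v. block v n - ?A n *v block v (n - 1))) (at s)" if "1 \<le> n" "n \<le> CARD('t)" for n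
    unfolding dyn_jacobian_def
    by (intro has_derivative_diff state_has_derivative
        has_derivative_compose[OF state_has_derivative jacobian_works[THEN iffD1]] diff that)
  have deriv: "(residual f s0 has_derivative ?R) (at s)"
    unfolding has_derivative_componentwise_within[of "residual f s0"]
    by (auto simp: Basis_vec_def inner_axis residual_def Let_def
        simp del: vector_minus_component One_nat_def
        intro!: bounded_linear.has_derivative[OF bounded_linear_vec_nth] step timestep_bounds)
  then have "(residual f s0 has_derivative (*v) (jacobian (residual f s0) (at s))) (at s)"
    by (intro jacobian_works[THEN iffD1] differentiableI)
  then have J: "jacobian (residual f s0) (at s) *v v = ?R v" for v
    using deriv by (rule has_derivative_unique[THEN fun_cong])
  obtain i :: 't where "t = timestep i"
    using t bij_betw_timestep[where 't='t] by (force simp: bij_betw_def)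
  then show "block (jacobian (residual f s0) (at s) *v v) t = block v t - ?A t *v block v (t - 1)"
    by (simp add: J vec_eq_iff)
qed

lemma sqrt_PL_constant_le: "sqrt (PL_constant r) \<le> sigma_min (jacobian r (at s))"
proof -
  have "PL_constant r \<le> (sigma_min (jacobian r (at s)))\<^sup>2"
    unfolding PL_constant_def by (rule cINF_lower) (auto intro!: bdd_belowI[of _ 0])
  then show ?thesis
    by (intro real_le_lsqrt sigma_min_nonneg)
qed

lemma sqrt_PL_constant_ge:
  assumes "\<And>s. c \<le> sigma_min (jacobian r (at s))" "0 \<le> c"
  shows "c \<le> sqrt (PL_constant r)"
  unfolding PL_constant_def
  using assms by (intro real_le_rsqrt cINF_greatest power_mono) auto

lemma sum_triangle_const:
  "(\<Sum>j=1..n. \<Sum>t=j..n. c) = (c :: real) * (real n * (real n + 1) / 2)"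
proof -
  have "(\<Sum>j=1..n. \<Sum>t=j..n. c) = (\<Sum>j=1..n. c * (real n + 1 - real j))"
    by (rule sum.cong) auto
  also have "\<dots> = c * (\<Sum>j=1..n. real n + 1 - real j)"
    by (simp add: sum_distrib_left)
  also have "(\<Sum>j=1..n. real n + 1 - real j) = real n * (real n + 1) - (\<Sum>j=1..n. real j)"
    by (simp add: sum_subtractf)
  also have "(\<Sum>j=1..n. real j) = real n * (real n + 1) / 2"
    by (induction n) (auto simp: field_simps)
  finally show ?thesis
    by (simp add: field_simps)
qed

theorem theorem5p3:
  fixes f :: "nat \<Rightarrow> real ^ 'd \<Rightarrow> real ^ 'd"
    and s0 :: "real ^ 'd"
    and T :: nat
    and lam a b \<mu> :: real
  assumes T: "T = CARD('t::{finite,linorder})"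
    and diff: "\<And>t x. 1 \<le> t \<Longrightarrow> t \<le> T \<Longrightarrow> f t differentiable (at x)"
    and a: "a \<ge> 1"
    and b: "0 < b" "b \<le> 1"
    and regular: "\<And>t k (s :: real ^ ('t \<times> 'd)). 1 < t \<Longrightarrow> t + k - 1 \<le> T \<Longrightarrow>
      b * exp (lam * real k) \<le> spectral_norm (A_prod (dyn_jacobian f s0 s) t k) \<and>
      spectral_norm (A_prod (dyn_jacobian f s0 s) t k) \<le> a * exp (lam * real k)"
    and \<mu>: "\<mu> = PL_constant (residual f s0 :: real ^ ('t \<times> 'd) \<Rightarrow> real ^ ('t \<times> 'd))"
  shows "(lam \<noteq> 0 \<longrightarrow>
            1 / a * ((exp lam - 1) / (exp (lam * real T) - 1)) \<le> sqrt \<mu> \<and>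
            sqrt \<mu> \<le> min (1 / b * (1 / exp (lam * (real T - 1)))) 1) \<and>
         (lam = 0 \<longrightarrow>
            1 / (a * real T) \<le> sqrt \<mu> \<and>
            sqrt \<mu> \<le> min (1 / b * sqrt (2 * real CARD('d) / (real T + 1))) 1)"
proof -
  let ?r = "residual f s0 :: real ^ ('t \<times> 'd) \<Rightarrow> real ^ ('t \<times> 'd)"
  let ?J = "\<lambda>s. jacobian ?r (at s)"
  let ?A = "dyn_jacobian f s0 :: real ^ ('t \<times> 'd) \<Rightarrow> nat \<Rightarrow> real ^ 'd ^ 'd"
  let ?\<sigma> = "sigma_min (?J 0)"
  have bidiag: "block_bidiagonal (?A s) (?J s)" for s
    using diff by (intro residual_block_bidiagonal) (simp add: T)
  interpret J0: block_bidiagonal "?A 0" "?J 0"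
    by (rule bidiag)
  have T1: "1 \<le> T"
    by (simp add: T Suc_le_eq)
  have \<sigma>: "0 \<le> ?\<sigma>"
    by (rule sigma_min_nonneg)
  have upper: "sqrt \<mu> \<le> ?\<sigma>"
    unfolding \<mu> by (rule sqrt_PL_constant_le)
  define S where "S = (\<Sum>k<T. a * exp (lam * real k))"
  have S: "0 < S"
    unfolding S_def using a T1 by (intro sum_pos) (auto simp: lessThan_empty_iff)
  have lower: "1 / S \<le> sqrt \<mu>"
    unfolding \<mu>
  proof (intro sqrt_PL_constant_ge sigma_min_ge)
    fix s v :: "real ^ ('t \<times> 'd)"
    have "norm v \<le> S * norm (?J s *v v)"
      unfolding S_def T
      using regular a
      by (intro block_bidiagonal.norm_le_subdiagonal_sum[OF bidiag]) (auto simp: T)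
    then show "1 / S * norm v \<le> norm (?J s *v v)"
      using S by (simp add: field_simps)
  qed (use S in simp)
  \<comment> \<open>The diagonal blocks of the inverse are identities.\<close>
  have "spectral_norm (mat 1 :: real ^ 'd ^ 'd) = 1"
    unfolding spectral_norm_def matrix_vector_mul_lid by (rule onorm_id)
  then have le1: "?\<sigma> \<le> 1"
    using J0.sigma_min_block_le[of 1 1] T1 by (simp add: T)
  have exp_case: "?\<sigma> \<le> 1 / b * (1 / exp (lam * (real T - 1)))"
  proof -
    \<comment> \<open>The corner block of the inverse, which propagates the first block to the last one.\<close>
    have "b * exp (lam * real (T - 1)) \<le> spectral_norm (A_prod (?A 0) (1 + 1) (T - 1))"
      using regular[of "1 + 1" "T - 1"] T1 by simp
    from mult_left_mono[OF this \<sigma>] have "?\<sigma> * (b * exp (lam * (real T - 1))) \<le> 1"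
      using J0.sigma_min_block_le[of 1 T] T1 by (simp add: T)
    then show ?thesis
      using b by (simp add: field_simps)
  qed
  have sqrt_case: "?\<sigma> \<le> 1 / b * sqrt (2 * real CARD('d) / (real T + 1))" if lam: "lam = 0"
  proof -
    have "(\<Sum>j=1..T. \<Sum>t=j..T. b\<^sup>2)
        \<le> (\<Sum>j=1..T. \<Sum>t=j..T. (spectral_norm (A_prod (?A 0) (j + 1) (t - j)))\<^sup>2)"
    proof (intro sum_mono power_mono)
      fix j t assume "j \<in> {1..T}" "t \<in> {j..T}"
      then show "b \<le> spectral_norm (A_prod (?A 0) (j + 1) (t - j))"
        using regular[of "j + 1" "t - j" 0] lam by simp
    qed (use b in simp)
    then have "?\<sigma>\<^sup>2 * (b\<^sup>2 * (real T * (real T + 1) / 2))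
        \<le> ?\<sigma>\<^sup>2 * (\<Sum>j=1..T. \<Sum>t=j..T. (spectral_norm (A_prod (?A 0) (j + 1) (t - j)))\<^sup>2)"
      unfolding sum_triangle_const by (intro mult_left_mono) auto
    also have "\<dots> \<le> real T * real CARD('d)"
      unfolding T by (rule J0.sigma_min_Frobenius)
    finally have "real T * (?\<sigma>\<^sup>2 * b\<^sup>2 * (real T + 1)) \<le> real T * (2 * real CARD('d))"
      by (simp add: field_simps)
    then have "(?\<sigma> * b)\<^sup>2 * (real T + 1) \<le> 2 * real CARD('d)"
      using T1 by (simp add: power_mult_distrib)
    then have "(?\<sigma> * b)\<^sup>2 \<le> 2 * real CARD('d) / (real T + 1)"
      by (simp add: pos_le_divide_eq)
    then have "?\<sigma> * b \<le> sqrt (2 * real CARD('d) / (real T + 1))"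
      by (rule real_le_rsqrt)
    then show ?thesis
      using b by (simp add: field_simps)
  qed
  have S_ne: "1 / a * ((exp lam - 1) / (exp (lam * real T) - 1)) = 1 / S" if "lam \<noteq> 0"
  proof -
    have "S = a * (\<Sum>k<T. exp lam ^ k)"
      by (simp add: S_def sum_distrib_left exp_of_nat2_mult)
    also have "\<dots> = a * ((exp (lam * real T) - 1) / (exp lam - 1))"
      using that by (simp add: geometric_sum exp_of_nat2_mult)
    finally show ?thesis
      by simp
  qed
  have S_eq: "1 / (a * real T) = 1 / S" if "lam = 0"
    using that by (simp add: S_def mult.commute)
  show ?thesis
    using lower S_ne S_eq order_trans[OF upper le1] order_trans[OF upper exp_case]
      order_trans[OF upper sqrt_case] by simp
qed

end
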